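(* The infinite word $\mathbf{b}$ is recurrent, i.e., every finite factor of $\mathbf{b}$ occurs infinitely often in $\mathbf{b}$.
   Context: Define finite binary words $B_i$ by $B_1 = 101$ and $B_{i+1} = B_i C_i$ for $i \geq 1$, where $C_i$ is the word obtained from $B_i$ by removing its first $i$ symbols. Since each $B_i$ is a prefix of $B_{i+1}$, there is a unique infinite binary word $\mathbf{b} = 10101101011011101\cdots$ of which every $B_i$ is a prefix. *)

theory Defs
  imports "HOL-Library.Omega_Words_Fun"
begin

text \<open>
  Binary words are lists over \<^typ>\<open>bool\<close>, with \<^term>\<open>True\<close> for the letter 1 and
  \<^term>\<open>False\<close> for the letter 0. Infinite words are functions on \<^typ>\<open>nat\<close>, so positions
  are counted from 0.
\<close>

text \<open>The words \<open>B\<^sub>i\<close> are indexed from 1; the value at 0 is a dummy.\<close>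

fun B :: "nat \<Rightarrow> bool list" where
  "B 0 = []"
| "B (Suc 0) = [True, False, True]"
| "B (Suc (Suc n)) = B (Suc n) @ drop (Suc n) (B (Suc n))"

definition C :: "nat \<Rightarrow> bool list" where
  "C i = drop i (B i)"

definition is_prefix :: "'a list \<Rightarrow> 'a word \<Rightarrow> bool" where
  "is_prefix u w \<longleftrightarrow> prefix (length u) w = u"

definition occurs_at :: "'a list \<Rightarrow> 'a word \<Rightarrow> nat \<Rightarrow> bool" where
  "occurs_at u w n \<longleftrightarrow> w [n \<rightarrow> n + length u] = u"

definition factor :: "'a list \<Rightarrow> 'a word \<Rightarrow> bool" where
  "factor u w \<longleftrightarrow> (\<exists>n. occurs_at u w n)"

definition recurrent :: "'a word \<Rightarrow> bool" where
  "recurrent w \<longleftrightarrow> (\<forall>u. factor u w \<longrightarrow> infinite {n. occurs_at u w n})"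

definition bword :: "bool word" where
  "bword = (THE w. \<forall>i\<ge>1. is_prefix (B i) w)"

text \<open>
  Existence and uniqueness of the word just described, which justify the description operator.
\<close>

lemma B_1: "B 1 = [True, False, True]"
  by simp

lemma B_Suc: "B (i + 1) = B i @ C i" if "i \<ge> 1"
  using that by (cases i) (simp_all add: C_def)

lemma length_B: "i + 2 \<le> length (B i)" if "i \<ge> 1"
  using that
proof (induction i rule: dec_induct)
  case (step i)
  then show ?case using B_Suc[of i] by (simp add: C_def)
qed simp

lemma B_prefix: "\<exists>v. B j = B i @ v" if "i \<ge> 1" "i \<le> j"
  using that(2)
proof (induction j rule: dec_induct)
  case (step j)
  then obtain v where "B j = B i @ v" by blast
  with B_Suc[of j] step that(1) show ?case by simp
qed simp

lemma nth_B_eq: "B i ! k = B j ! k"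
  if ij: "i \<ge> 1" "j \<ge> 1" and k: "k < length (B i)" "k < length (B j)"
proof (cases "i \<le> j")
  case True
  then obtain v where "B j = B i @ v" using B_prefix ij by blast
  then show ?thesis using k by (simp add: nth_append)
next
  case False
  then obtain v where "B i = B j @ v" using B_prefix[of j i] ij by auto
  then show ?thesis using k by (simp add: nth_append)
qed

lemma is_prefix_iff_nth: "is_prefix u w \<longleftrightarrow> (\<forall>k<length u. w k = u ! k)"
  unfolding is_prefix_def list_eq_iff_nth_eq by simp

lemma ex1_bword: "\<exists>!w. \<forall>i\<ge>1. is_prefix (B i) w"
proof (rule ex1I)
  show "\<forall>i\<ge>1. is_prefix (B i) (\<lambda>k. B (Suc k) ! k)"
    unfolding is_prefix_iff_nth
  proof (intro allI impI)
    fix i k :: nat assume "i \<ge> 1" "k < length (B i)"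
    moreover have "k < length (B (Suc k))" using length_B[of "Suc k"] by linarith
    ultimately show "B (Suc k) ! k = B i ! k" by (intro nth_B_eq) simp_all
  qed
next
  fix w assume w: "\<forall>i\<ge>1. is_prefix (B i) w"
  show "w = (\<lambda>k. B (Suc k) ! k)"
  proof
    fix k
    have "is_prefix (B (Suc k)) w" using w by simp
    moreover have "k < length (B (Suc k))" using length_B[of "Suc k"] by linarith
    ultimately show "w k = B (Suc k) ! k" by (metis is_prefix_iff_nth)
  qed
qed

lemma is_prefix_B_bword: "is_prefix (B i) bword" if "i \<ge> 1"
  using theI'[OF ex1_bword] that unfolding bword_def by blast

lemma prefix_17_bword:
  "prefix 17 bword = map (\<lambda>x. x = (1::nat)) [1,0,1,0,1,1,0,1,0,1,1,0,1,1,1,0,1]"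
proof -
  have "take 17 (prefix (length (B 5)) bword) = take 17 (B 5)"
    using is_prefix_B_bword[of 5] by (simp add: is_prefix_def)
  moreover have "length (B 5) = 22" by (simp add: eval_nat_numeral)
  ultimately show ?thesis by (simp add: eval_nat_numeral)
qed

end

theory Submission
  imports Defs
begin

text \<open>
  Say that \<open>B\<^sub>k\<close> is final if it is a suffix of \<open>B\<^sub>m\<close> for all \<open>m \<ge> k\<close>. The word \<open>B\<^sub>1\<close> is final.
  If \<open>B\<^sub>k\<close> is final and \<open>n\<close> is the length of \<open>B\<^sub>k\<close>, then \<open>B\<^sub>n = x B\<^sub>k\<close>, and since \<open>B\<^sub>k\<close> is also
  the prefix of length \<open>n\<close> of \<open>B\<^sub>n\<close>, we get \<open>B\<^sub>n\<^sub>+\<^sub>1 = x B\<^sub>k C\<^sub>n = x B\<^sub>n\<close>. Here \<open>x\<close> is longer than \<open>n\<close>, so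
  removing the first \<open>m > n\<close> symbols of \<open>B\<^sub>m\<close> never reaches this suffix, and \<open>B\<^sub>n\<close> is final too.
  So there are arbitrarily long final \<open>B\<^sub>n\<close>, and each of them occurs infinitely often.
\<close>

definition final_B :: "nat \<Rightarrow> bool" where
  "final_B k \<longleftrightarrow> k \<ge> 1 \<and> (\<forall>m\<ge>k. \<exists>x. B m = x @ B k)"

text \<open>Splitting off a suffix of length \<open>n\<close> from \<open>B n\<close> leaves at
  least \<open>n + 1\<close> symbols, the number removed from \<open>B (Suc n)\<close> at the next
  step.\<close>

lemma length_B_ge_double: "2 * n + 1 \<le> length (B n)" if "n \<ge> 3"
  using that
proof (induction n rule: dec_induct)
  case base
  show ?case by (simp add: eval_nat_numeral)
next
  case (step n)
  then show ?case using B_Suc[of n] by (simp add: C_def)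
qed

lemma B_suffix_persists:
  assumes "1 \<le> m" "B m = x @ v" "m \<le> length x" "m \<le> m'"
  shows "\<exists>y. B m' = y @ v \<and> m' \<le> length y"
  using assms(4)
proof (induction m' rule: dec_induct)
  case base
  show ?case using assms by blast
next
  case (step i)
  then obtain y where y: "B i = y @ v" "i \<le> length y" by blast
  have "i \<ge> 1" using assms(1) step by simp
  \<comment> \<open>The new prefix contains all of \<open>B i\<close>, which has more than
    \<open>i\<close> symbols, so the length bound renews itself.\<close>
  then have "B (Suc i) = (B i @ drop i y) @ v" and "Suc i \<le> length (B i @ drop i y)"
    using y B_Suc[of i] length_B[of i] by (simp_all add: C_def)
  then show ?case by blast
qed

lemma final_B_1: "final_B 1"
  unfolding final_B_def
proof (intro conjI allI impI)
  fix m :: nat assume "m \<ge> 1"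
  show "\<exists>x. B m = x @ B 1"
  proof (cases "m = 1")
    case False
    \<comment> \<open>At \<open>m = 1\<close> the prefix is empty, too short for persistence, so it
      starts from \<open>B 2\<close>.\<close>
    have "B 2 = [True, False] @ B 1" by (simp add: eval_nat_numeral)
    then show ?thesis
      using B_suffix_persists[of 2 "[True, False]" "B 1" m] False \<open>m \<ge> 1\<close> by auto
  qed simp
qed simp

lemma final_B_length:
  assumes "final_B k"
  shows "final_B (length (B k))"
proof -
  define n where "n = length (B k)"
  have k: "k \<ge> 1" using assms by (simp add: final_B_def)
  have n: "n \<ge> k + 2" using length_B[OF k] by (simp add: n_def)
  obtain x where x: "B n = x @ B k" using assms n unfolding final_B_def by (meson add_leD1)
  obtain v where v: "B n = B k @ v" using B_prefix[OF k, of n] n by auto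
  have "drop n (B n) = v" unfolding v by (simp add: n_def)
  then have "B (Suc n) = B n @ v" using B_Suc[of n] n by (simp add: C_def)
  also have "\<dots> = x @ B k @ v" unfolding x by simp
  also have "\<dots> = x @ B n" unfolding v ..
  finally have "B (Suc n) = x @ B n" .
  moreover have "Suc n \<le> length x"
  proof -
    have "length (B n) = length x + n" unfolding x by (simp add: n_def)
    then show ?thesis using length_B_ge_double[of n] n k by linarith
  qed
  ultimately have "\<exists>y. B m = y @ B n" if "m > n" for m
    using B_suffix_persists[of "Suc n" x "B n" m] that Suc_leI[of n m] by (metis One_nat_def Suc_le_mono zero_le)
  then have "\<exists>y. B m = y @ B n" if "m \<ge> n" for m
    using that by (metis append_Nil order_le_less)
  then have "final_B n" using n unfolding final_B_def by simp
  then show ?thesis unfolding n_def .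
qed

lemma ex_final_B_ge: "\<exists>n\<ge>N. final_B n"
proof (induction N)
  case 0
  show ?case using final_B_1 by blast
next
  case (Suc N)
  then obtain n where n: "n \<ge> N" "final_B n" by blast
  then have "length (B n) \<ge> Suc N" using length_B[of n] by (simp add: final_B_def)
  then show ?case using final_B_length[OF n(2)] by blast
qed

lemma bword_nth: "bword k = B i ! k" if "i \<ge> 1" "k < length (B i)"
  using is_prefix_B_bword[OF that(1)] that(2) by (simp add: is_prefix_iff_nth)

lemma occurs_at_iff_nth: "occurs_at u w n \<longleftrightarrow> (\<forall>k<length u. w (n + k) = u ! k)"
  unfolding occurs_at_def list_eq_iff_nth_eq by simp

text \<open>\<open>B m\<close> is a prefix of \<open>bword\<close>, so its final \<open>B n\<close>
  repeats what the initial one contains.\<close>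

lemma occurs_at_bword_shift:
  assumes "n \<ge> 1" "m \<ge> 1" "B m = x @ B n" "occurs_at u bword p" "p + length u \<le> length (B n)"
  shows "occurs_at u bword (length x + p)"
  unfolding occurs_at_iff_nth
proof (intro allI impI)
  fix k assume k: "k < length u"
  have "bword (length x + p + k) = B m ! (length x + (p + k))"
    using bword_nth[OF assms(2), of "length x + p + k"] assms(3,5) k by (simp add: add.assoc)
  also have "\<dots> = bword (p + k)"
    using bword_nth[OF assms(1), of "p + k"] assms(3,5) k by (simp add: nth_append)
  also have "\<dots> = u ! k" using assms(4) k by (simp add: occurs_at_iff_nth)
  finally show "bword (length x + p + k) = u ! k" .
qed

theorem theorem3:
  shows "recurrent bword"
  unfolding recurrent_def
proof (intro allI impI)
  fix u assume "factor u bword"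
  then obtain p where p: "occurs_at u bword p" by (auto simp: factor_def)
  obtain n where n: "n \<ge> p + length u" "final_B n" using ex_final_B_ge by blast
  have n1: "n \<ge> 1" using n(2) by (simp add: final_B_def)
  have "\<exists>q\<ge>M. occurs_at u bword q" for M
  proof -
    \<comment> \<open>\<open>B m\<close> has length at least \<open>m\<close>, so its final
      \<open>B n\<close> starts at or after \<open>M\<close>.\<close>
    define m where "m = M + length (B n)"
    have m: "m \<ge> n" using length_B[OF n1] by (simp add: m_def)
    then obtain x where x: "B m = x @ B n" using n(2) unfolding final_B_def by blast
    have "length (B m) \<ge> m" using length_B[of m] m n1 by simp
    then have "length x + p \<ge> M" using x by (simp add: m_def)
    moreover have "occurs_at u bword (length x + p)"
      using occurs_at_bword_shift[OF n1 _ x p] n1 m n(1) length_B[OF n1] by linarith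
    ultimately show ?thesis by blast
  qed
  then show "infinite {q. occurs_at u bword q}"
    by (simp add: infinite_nat_iff_unbounded_le)
qed

end
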